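(* Let $n,m,N\ge 1$ be integers, $X_1,\dots,X_n\in\mathbb{R}$, $a_1,\dots,a_m\in\mathbb{R}$, and $T>0$. Let $Z$, $\{Z\}$, $p_z$, $G$, $g_k$ and $\tilde f$ be as defined in the context. Then for all $x\in\mathbb{R}$, $$\tilde f(x)=\frac{T}{N}\sum_{z\in\{Z\}}p_z\,R_{N,T}(x-z),$$ where $$R_{N,T}(x):=\frac1T\cdot\frac{\sin\left(2\pi\,\frac{2N-1}{2T}\,x\right)}{\sin\left(2\pi\,\frac{1}{2T}\,x\right)},$$ the right-hand side being extended continuously at the zeros of the denominator.
   Context: $\mathrm{i}$ denotes the imaginary unit. Let $\hat F_n(x)=n^{-1}\sum_{l=1}^n 1_{X_l\le x}$ be the empirical distribution function of the fixed real numbers $X_1,\dots,X_n$. Let $X^{[1]},\dots,X^{[m]}$ be independent random variables, each with distribution function $\hat F_n$, and set $Z:=\sum_{j=1}^m a_jX^{[j]}$. $\{Z\}$ denotes the finite set of values that $Z$ takes with positive probability, and $p_z:=P(Z=z)$ for $z\in\{Z\}$. Define $G(\nu):=\prod_{j=1}^m\left(\frac1n\sum_{l=1}^n\exp(-2\pi\mathrm{i}\,a_jX_l\nu)\right)$ for $\nu\in\mathbb{R}$, $\Delta\nu:=1/T$, $g_k:=G(k\,\Delta\nu)$ for $k\in\mathbb{Z}$, and $$\tilde f(x):=\frac1N\sum_{k=-N+1}^{N-1}g_k\exp(2\pi\mathrm{i}\,xk/T),\qquad x\in\mathbb{R}.$$ *)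

theory Defs
  imports "HOL-Probability.Probability"
begin

definition emp_cdf :: "nat \<Rightarrow> (nat \<Rightarrow> real) \<Rightarrow> real \<Rightarrow> real" where
  "emp_cdf n X x = (1 / real n) * (\<Sum>l=1..n. of_bool (X l \<le> x))"

definition lin_comb :: "nat \<Rightarrow> (nat \<Rightarrow> real) \<Rightarrow> (nat \<Rightarrow> 'w \<Rightarrow> real) \<Rightarrow> 'w \<Rightarrow> real" where
  "lin_comb m a Y \<omega> = (\<Sum>j=1..m. a j * Y j \<omega>)"

definition point_prob :: "'w measure \<Rightarrow> ('w \<Rightarrow> real) \<Rightarrow> real \<Rightarrow> real" where
  "point_prob M Z z = \<P>(\<omega> in M. Z \<omega> = z)"

definition pos_values :: "'w measure \<Rightarrow> ('w \<Rightarrow> real) \<Rightarrow> real set" where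
  "pos_values M Z = {z. point_prob M Z z > 0}"

definition G_fun :: "nat \<Rightarrow> (nat \<Rightarrow> real) \<Rightarrow> nat \<Rightarrow> (nat \<Rightarrow> real) \<Rightarrow> real \<Rightarrow> complex" where
  "G_fun n X m a \<nu> =
     (\<Prod>j=1..m. (1 / of_nat n) *
        (\<Sum>l=1..n. exp (- 2 * of_real pi * \<i> * of_real (a j) * of_real (X l) * of_real \<nu>)))"

definition g_coeff :: "nat \<Rightarrow> (nat \<Rightarrow> real) \<Rightarrow> nat \<Rightarrow> (nat \<Rightarrow> real) \<Rightarrow> real \<Rightarrow> int \<Rightarrow> complex" where
  "g_coeff n X m a T k = (let \<Delta>\<nu> = 1 / T in G_fun n X m a (of_int k * \<Delta>\<nu>))"

definition f_tilde ::
  "nat \<Rightarrow> (nat \<Rightarrow> real) \<Rightarrow> nat \<Rightarrow> (nat \<Rightarrow> real) \<Rightarrow> nat \<Rightarrow> real \<Rightarrow> real \<Rightarrow> complex" where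
  "f_tilde n X m a N T x =
     (1 / of_nat N) *
       (\<Sum>k = - int N + 1..int N - 1.
          g_coeff n X m a T k * exp (2 * of_real pi * \<i> * of_real x * of_int k / of_real T))"

definition R_quot :: "nat \<Rightarrow> real \<Rightarrow> real \<Rightarrow> real" where
  "R_quot N T x =
     (1 / T) * (sin (2 * pi * ((2 * real N - 1) / (2 * T)) * x) / sin (2 * pi * (1 / (2 * T)) * x))"

text \<open>Division by zero yields zero in HOL, so at the zeros of the denominator the value of the
  continuous extension is taken to be the limit of the quotient (over a punctured neighbourhood).\<close>

definition R_ker :: "nat \<Rightarrow> real \<Rightarrow> real \<Rightarrow> real" where
  "R_ker N T x =
     (if sin (2 * pi * (1 / (2 * T)) * x) = 0 then Lim (at x) (R_quot N T) else R_quot N T x)"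

end

theory Submission
  imports Defs
begin

text \<open>By independence, \<open>G \<nu>\<close> is the characteristic function of \<open>Z\<close> at \<open>- 2 * pi * \<nu>\<close>, and \<open>Z\<close> takes
  almost surely finitely many values, so \<open>G \<nu>\<close> is the sum of \<open>p\<^sub>z * cis (- 2 * pi * \<nu> * z)\<close>.
  Exchanging the sums over \<open>k\<close> and \<open>z\<close> in the definition of \<open>f_tilde\<close> leaves for each \<open>z\<close> a Dirichlet
  kernel evaluated at \<open>x - z\<close>. That kernel is continuous and agrees with \<open>T * R_quot\<close> away from the
  isolated zeros of the denominator, hence equals \<open>T * R_ker\<close> everywhere.\<close>

text \<open>The terms at \<open>k\<close> and \<open>- k\<close> are conjugate, so each pair
  contributes twice a cosine. The induction adjoins the two new end indices.\<close>

lemma sum_cis_symmetric: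
  "(\<Sum>k = - int p..int p. cis (of_int k * \<theta>)) = of_real (1 + 2 * (\<Sum>k=1..p. cos (real k * \<theta>)))"
proof (induction p)
  case (Suc p)
  have "{- int (Suc p)..int (Suc p)} = insert (- int (Suc p)) (insert (int (Suc p)) {- int p..int p})"
    by auto
  then have "(\<Sum>k = - int (Suc p)..int (Suc p). cis (of_int k * \<theta>)) =
      cis (- (real (Suc p) * \<theta>)) + cis (real (Suc p) * \<theta>) + (\<Sum>k = - int p..int p. cis (of_int k * \<theta>))"
    by (simp add: algebra_simps)
  also have "cis (- (real (Suc p) * \<theta>)) + cis (real (Suc p) * \<theta>) = of_real (2 * cos (real (Suc p) * \<theta>))"
    by (simp add: complex_eq_iff del: of_nat_Suc)
  finally show ?case
    by (simp add: Suc.IH del: of_nat_Suc)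
qed simp

text \<open>The sum telescopes: by the product formula each summand times
  \<open>sin (\<theta> / 2)\<close> is a difference of sines at consecutive half-odd multiples of
  \<open>\<theta>\<close>. The form without division stays valid at the zeros of
  \<open>sin (\<theta> / 2)\<close>.\<close>

lemma dirichlet_kernel_times_sin:
  fixes \<theta> :: real
  shows "(1 + 2 * (\<Sum>k=1..p. cos (real k * \<theta>))) * sin (\<theta> / 2) = sin ((2 * real p + 1) * \<theta> / 2)"
proof (induction p)
  case (Suc p)
  have "2 * cos (real (Suc p) * \<theta>) * sin (\<theta> / 2) =
      sin ((2 * real (Suc p) + 1) * \<theta> / 2) - sin ((2 * real p + 1) * \<theta> / 2)"
  proof -
    have eqs: "real (Suc p) * \<theta> + \<theta> / 2 = (2 * real (Suc p) + 1) * \<theta> / 2"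
      "real (Suc p) * \<theta> - \<theta> / 2 = (2 * real p + 1) * \<theta> / 2"
      by (simp_all add: field_simps)
    show ?thesis
      unfolding eqs[symmetric] by (simp add: mult.assoc cos_times_sin del: of_nat_Suc)
  qed
  with Suc.IH show ?case
    by (simp add: distrib_right distrib_left del: of_nat_Suc)
qed simp

text \<open>The zero at \<open>x\<close> is simple: the difference quotient there tends to the
  derivative, which is \<open>c\<close> or \<open>- c\<close> because the cosine is 1 or -1 where
  the sine vanishes.\<close>

lemma eventually_at_sin_mult_nonzero:
  fixes c x :: real
  assumes "c \<noteq> 0" and "sin (c * x) = 0"
  shows "\<forall>\<^sub>F y in at x. sin (c * y) \<noteq> 0"
proof -
  have "((\<lambda>y. sin (c * y)) has_real_derivative c * cos (c * x)) (at x)"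
    by (auto intro!: derivative_eq_intros)
  then have "((\<lambda>y. sin (c * y) / (y - x)) \<longlongrightarrow> c * cos (c * x)) (at x)"
    using assms by (simp add: has_field_derivative_iff)
  moreover have "c * cos (c * x) \<noteq> 0"
    using assms sin_zero_abs_cos_one by fastforce
  ultimately have "\<forall>\<^sub>F y in at x. sin (c * y) / (y - x) \<noteq> 0"
    by (rule tendsto_imp_eventually_ne)
  then show ?thesis
    by eventually_elim auto
qed

text \<open>The right-hand side is a trigonometric polynomial, hence continuous, so it also supplies
  the limit by which \<open>R_ker\<close> is defined at the zeros of the denominator.\<close>

lemma R_ker_eq_sum_cos:
  assumes "T > 0"
  shows "T * R_ker (Suc p) T x = 1 + 2 * (\<Sum>k=1..p. cos (real k * (2 * pi * x / T)))"
proof -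
  define D where "D y = 1 + 2 * (\<Sum>k=1..p. cos (real k * (2 * pi * y / T)))" for y
  have quot: "R_quot (Suc p) T y = D y / T" if "sin (2 * pi * (1 / (2 * T)) * y) \<noteq> 0" for y
  proof -
    have "D y * sin (2 * pi * (1 / (2 * T)) * y) = sin (2 * pi * ((2 * real (Suc p) - 1) / (2 * T)) * y)"
      \<comment> \<open>This angle makes \<open>\<theta> / 2\<close> the argument of the denominator
        and \<open>(2 * real p + 1) * \<theta> / 2\<close> that of the numerator, since
        \<open>2 * real (Suc p) - 1 = 2 * real p + 1\<close>.\<close>
      using dirichlet_kernel_times_sin[where p = p and \<theta> = "2 * pi * y / T"]
      by (simp add: D_def field_simps)
    then have "D y = sin (2 * pi * ((2 * real (Suc p) - 1) / (2 * T)) * y) / sin (2 * pi * (1 / (2 * T)) * y)"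
      using that by (metis nonzero_eq_divide_eq)
    then show ?thesis
      by (simp add: R_quot_def)
  qed
  have "R_ker (Suc p) T x = D x / T"
  proof (cases "sin (2 * pi * (1 / (2 * T)) * x) = 0")
    case True
    \<comment> \<open>The zero is isolated, so the quotient agrees with \<open>D y / T\<close> on a
      punctured neighbourhood and inherits its limit.\<close>
    have "\<forall>\<^sub>F y in at x. sin (2 * pi * (1 / (2 * T)) * y) \<noteq> 0"
      using assms True by (intro eventually_at_sin_mult_nonzero) auto
    then have ev: "\<forall>\<^sub>F y in at x. D y / T = R_quot (Suc p) T y"
      by eventually_elim (simp add: quot)
    have "((\<lambda>y. D y / T) \<longlongrightarrow> D x / T) (at x)"
      unfolding D_def using assms by (intro tendsto_intros) auto
    then have "(R_quot (Suc p) T \<longlongrightarrow> D x / T) (at x)"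
      by (rule Lim_transform_eventually[OF _ ev])
    then have "Lim (at x) (R_quot (Suc p) T) = D x / T"
      by (intro tendsto_Lim) auto
    with True show ?thesis
      by (simp add: R_ker_def)
  qed (simp add: R_ker_def quot)
  with assms show ?thesis
    by (simp add: D_def)
qed

text \<open>A law on the real line is determined by its distribution function. Drawing a uniform
  index, rather than a value, accounts for repetitions among the \<open>X l\<close>.\<close>

lemma distr_eq_uniform_of_emp_cdf:
  assumes "prob_space M" and [measurable]: "W \<in> borel_measurable M"
    and "n \<ge> 1" and "cdf (distr M borel W) = emp_cdf n X"
  shows "distr M borel W = distr (measure_pmf (pmf_of_set {1..n})) borel X"
proof (rule cdf_unique)
  interpret prob_space M by fact
  show "real_distribution (distr M borel W)"
    by (rule real_distribution_distr) simp
  show "real_distribution (distr (measure_pmf (pmf_of_set {1..n})) borel X)"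
    by (rule prob_space.real_distribution_distr[OF prob_space_measure_pmf]) simp
  have "cdf (distr (measure_pmf (pmf_of_set {1..n})) borel X) x = emp_cdf n X x" for x
  proof -
    have "cdf (distr (measure_pmf (pmf_of_set {1..n})) borel X) x =
        measure (measure_pmf (pmf_of_set {1..n})) {l. X l \<le> x}"
      by (simp add: cdf_def measure_distr vimage_def)
    also have "\<dots> = real (card ({1..n} \<inter> {l. X l \<le> x})) / real n"
      using assms(3) by (subst measure_pmf_of_set) auto
    also have "\<dots> = emp_cdf n X x"
      by (simp add: emp_cdf_def of_bool_def flip: sum.inter_filter add: Int_def)
    finally show ?thesis .
  qed
  with assms(4) show "cdf (distr M borel W) = cdf (distr (measure_pmf (pmf_of_set {1..n})) borel X)"
    by auto
qed

text \<open>Almost surely \<open>h (Z \<omega>)\<close> is a finite combination of indicators of the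
  events \<open>Z \<omega> = z\<close>. The set \<open>F\<close> only has to cover the values of
  \<open>Z\<close> and may contain points of probability zero.\<close>

lemma (in prob_space) integral_finite_support:
  fixes h :: "real \<Rightarrow> 'b :: {banach, second_countable_topology}"
  assumes [measurable]: "Z \<in> borel_measurable M" "h \<in> borel_measurable borel"
    and "finite F" and "AE \<omega> in M. Z \<omega> \<in> F"
  shows "(\<integral>\<omega>. h (Z \<omega>) \<partial>M) = (\<Sum>z\<in>pos_values M Z. point_prob M Z z *\<^sub>R h z)"
proof -
  have "(\<integral>\<omega>. h (Z \<omega>) \<partial>M) = (\<integral>\<omega>. (\<Sum>z\<in>F. indicator {\<omega> \<in> space M. Z \<omega> = z} \<omega> *\<^sub>R h z) \<partial>M)"
  proof (rule integral_cong_AE)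
    show "AE \<omega> in M. h (Z \<omega>) = (\<Sum>z\<in>F. indicator {\<omega> \<in> space M. Z \<omega> = z} \<omega> *\<^sub>R h z)"
      using assms(4) AE_space
    proof eventually_elim
      case (elim \<omega>)
      have "(\<Sum>z\<in>F. indicator {\<omega> \<in> space M. Z \<omega> = z} \<omega> *\<^sub>R h z) = (\<Sum>z\<in>F. if Z \<omega> = z then h z else 0)"
        using elim by (intro sum.cong) (auto simp: indicator_def)
      with elim assms(3) show ?case
        by simp
    qed
  qed simp_all
  also have "\<dots> = (\<Sum>z\<in>F. point_prob M Z z *\<^sub>R h z)"
    by (simp add: point_prob_def emeasure_eq_measure Bochner_Integration.integral_sum)
  \<comment> \<open>A point outside \<open>F\<close> has probability zero, and points of
    \<open>F\<close> outside \<open>pos_values M Z\<close> carry zero weight.\<close>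
  also have "\<dots> = (\<Sum>z\<in>pos_values M Z. point_prob M Z z *\<^sub>R h z)"
  proof (rule sum.mono_neutral_right)
    show "pos_values M Z \<subseteq> F"
    proof
      fix z assume z: "z \<in> pos_values M Z"
      show "z \<in> F"
      proof (rule ccontr)
        assume "z \<notin> F"
        with assms(4) have "AE \<omega> in M. Z \<omega> \<noteq> z"
          by auto
        then have "point_prob M Z z = 0"
          unfolding point_prob_def by (subst prob_Collect_eq_0) auto
        with z show False
          by (simp add: pos_values_def)
      qed
    qed
    show "\<forall>z\<in>F - pos_values M Z. point_prob M Z z *\<^sub>R h z = 0"
      by (auto simp: pos_values_def point_prob_def not_less measure_le_0_iff)
  qed (fact assms(3))
  finally show ?thesis .
qed

theorem theorem1:
  fixes n m N :: nat and X a :: "nat \<Rightarrow> real" and T :: real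
    and M :: "'w measure" and Y :: "nat \<Rightarrow> 'w \<Rightarrow> real" and Z :: "'w \<Rightarrow> real"
  assumes "n \<ge> 1" and "m \<ge> 1" and "N \<ge> 1" and "T > 0"
    and "prob_space M"
    and "prob_space.indep_vars M (\<lambda>_. borel) Y {1..m}"
    and "\<forall>j\<in>{1..m}. cdf (distr M borel (Y j)) = emp_cdf n X"
    and "Z = lin_comb m a Y"
  shows "\<forall>x::real. f_tilde n X m a N T x =
    complex_of_real (T / real N * (\<Sum>z\<in>pos_values M Z. point_prob M Z z * R_ker N T (x - z)))"
proof
  fix x :: real
  interpret prob_space M by fact
  have Y_meas [measurable]: "Y j \<in> borel_measurable M" if "j \<in> {1..m}" for j
    using assms(6) that by (simp add: indep_vars_def)
  have Z_eq: "Z = (\<lambda>\<omega>. \<Sum>j=1..m. a j * Y j \<omega>)"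
    using assms(8) by (simp add: lin_comb_def fun_eq_iff)
  have Z_meas [measurable]: "Z \<in> borel_measurable M"
    unfolding Z_eq by measurable
  have distr_Y: "distr M borel (Y j) = distr (measure_pmf (pmf_of_set {1..n})) borel X"
    if "j \<in> {1..m}" for j
    using assms(7) that by (intro distr_eq_uniform_of_emp_cdf[OF assms(5) Y_meas assms(1)]) blast+

  \<comment> \<open>All sums that arise when each \<open>Y j\<close> takes one of the sample values.
    Extensional functions keep the set of choices finite, hence the \<open>restrict\<close>
    below.\<close>
  define F where "F = (\<lambda>y. \<Sum>j=1..m. a j * y j) ` (PiE {1..m} (\<lambda>_. X ` {1..n}))"
  have "finite F"
    unfolding F_def by (intro finite_imageI finite_PiE) auto
  have "AE \<omega> in M. Y j \<omega> \<in> X ` {1..n}" if j: "j \<in> {1..m}" for j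
  proof -
    have [measurable]: "X ` {1..n} \<in> sets borel"
      by (intro borel_closed finite_imp_closed) simp
    have "AE y in distr M borel (Y j). y \<in> X ` {1..n}"
      unfolding distr_Y[OF j] using assms(1) \<open>X ` {1..n} \<in> sets borel\<close>
      by (subst AE_distr_iff) (simp_all add: AE_measure_pmf_iff)
    with j \<open>X ` {1..n} \<in> sets borel\<close> show ?thesis
      by (subst (asm) AE_distr_iff) simp_all
  qed
  then have "AE \<omega> in M. \<forall>j\<in>{1..m}. Y j \<omega> \<in> X ` {1..n}"
    by (intro AE_finite_allI) auto
  then have AE_F: "AE \<omega> in M. Z \<omega> \<in> F"
  proof eventually_elim
    case (elim \<omega>)
    then have "restrict (\<lambda>j. Y j \<omega>) {1..m} \<in> PiE {1..m} (\<lambda>_. X ` {1..n})"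
      by auto
    moreover have "Z \<omega> = (\<Sum>j=1..m. a j * restrict (\<lambda>j. Y j \<omega>) {1..m} j)"
      unfolding Z_eq by (intro sum.cong) auto
    ultimately show ?case
      unfolding F_def by blast
  qed

  have G: "G_fun n X m a \<nu> = (\<Sum>z\<in>pos_values M Z. of_real (point_prob M Z z) * cis (- 2 * pi * \<nu> * z))" for \<nu>
  proof -
    let ?t = "- 2 * pi * \<nu>"
    \<comment> \<open>The average over \<open>l\<close> in each factor of \<open>G_fun\<close> is an
      expectation under the uniform index law, that is, under the law of \<open>Y j\<close>.\<close>
    have "char (distr M borel (\<lambda>\<omega>. a j * Y j \<omega>)) ?t =
        (1 / of_nat n) * (\<Sum>l=1..n. exp (- 2 * of_real pi * \<i> * of_real (a j) * of_real (X l) * of_real \<nu>))"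
      if j: "j \<in> {1..m}" for j
    proof -
      have [measurable]: "Y j \<in> borel_measurable M"
        using j by simp
      have "char (distr M borel (\<lambda>\<omega>. a j * Y j \<omega>)) ?t = (\<integral>y. iexp (?t * (a j * y)) \<partial>distr M borel (Y j))"
        by (simp add: char_def integral_distr)
      also have "\<dots> = (\<integral>l. iexp (?t * (a j * X l)) \<partial>measure_pmf (pmf_of_set {1..n}))"
        unfolding distr_Y[OF j] by (subst integral_distr) auto
      also have "\<dots> = (1 / of_nat n) * (\<Sum>l=1..n. iexp (?t * (a j * X l)))"
        using assms(1) by (subst integral_measure_pmf[of "{1..n}"])
          (auto simp: scaleR_conv_of_real sum_distrib_left)
      finally show ?thesis
        by (simp add: algebra_simps)
    qed
    then have "G_fun n X m a \<nu> = (\<Prod>j=1..m. char (distr M borel (\<lambda>\<omega>. a j * Y j \<omega>)) ?t)"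
      unfolding G_fun_def by (intro prod.cong) auto
    \<comment> \<open>Independence enters here: the characteristic function of a sum of independent
      variables is the product of theirs.\<close>
    also have "\<dots> = char (distr M borel Z) ?t"
      unfolding Z_eq
      by (rule char_distr_sum[symmetric], rule indep_vars_compose2[OF assms(6)]) measurable
    also have "\<dots> = (\<integral>\<omega>. cis (?t * Z \<omega>) \<partial>M)"
      by (simp add: char_def integral_distr cis_conv_exp)
    also have "\<dots> = (\<Sum>z\<in>pos_values M Z. point_prob M Z z *\<^sub>R cis (?t * z))"
      by (rule integral_finite_support[OF _ _ \<open>finite F\<close> AE_F]) (simp_all add: cis_conv_exp)
    finally show ?thesis
      by (simp add: scaleR_conv_of_real)
  qed

  \<comment> \<open>With \<open>p = N - 1\<close> the summation range of \<open>f_tilde\<close>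
    becomes the symmetric range of \<open>sum_cis_symmetric\<close>.\<close>
  obtain p where p: "N = Suc p"
    using assms(3) by (cases N) auto
  have "f_tilde n X m a N T x = (1 / of_nat N) * (\<Sum>k = - int p..int p. \<Sum>z\<in>pos_values M Z.
      of_real (point_prob M Z z) * cis (of_int k * (2 * pi * (x - z) / T)))"
  proof -
    have "g_coeff n X m a T k * exp (2 * of_real pi * \<i> * of_real x * of_int k / of_real T) =
        (\<Sum>z\<in>pos_values M Z. of_real (point_prob M Z z) * cis (of_int k * (2 * pi * (x - z) / T)))" for k
    proof -
      have "exp (2 * of_real pi * \<i> * of_real x * of_int k / of_real T) = cis (2 * pi * x * of_int k / T)"
        by (simp add: cis_conv_exp field_simps)
      \<comment> \<open>The phases add, so \<open>x\<close> and \<open>z\<close> enter only through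
        \<open>x - z\<close>.\<close>
      moreover have "cis (- 2 * pi * (of_int k / T) * z) * cis (2 * pi * x * of_int k / T) =
          cis (of_int k * (2 * pi * (x - z) / T))" for z
        by (simp add: cis_mult diff_divide_distrib algebra_simps)
      ultimately show ?thesis
        by (simp add: g_coeff_def G sum_distrib_right mult.assoc)
    qed
    then show ?thesis
      by (simp add: f_tilde_def p)
  qed
  also have "\<dots> = (1 / of_nat N) * (\<Sum>z\<in>pos_values M Z.
      of_real (point_prob M Z z) * (\<Sum>k = - int p..int p. cis (of_int k * (2 * pi * (x - z) / T))))"
    by (subst sum.swap) (simp add: sum_distrib_left)
  also have "\<dots> = (1 / of_nat N) * (\<Sum>z\<in>pos_values M Z.
      of_real (point_prob M Z z) * of_real (T * R_ker N T (x - z)))"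
    unfolding sum_cis_symmetric p R_ker_eq_sum_cos[OF assms(4)] ..
  also have "\<dots> = complex_of_real (T / real N * (\<Sum>z\<in>pos_values M Z. point_prob M Z z * R_ker N T (x - z)))"
    by (simp add: sum_distrib_left mult_ac)
  finally show "f_tilde n X m a N T x =
    complex_of_real (T / real N * (\<Sum>z\<in>pos_values M Z. point_prob M Z z * R_ker N T (x - z)))" .
qed

end
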